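(* Let $\theta>0$ and $\beta>1$. The moments $m_n=\mathbb{E}X^n$ of a random variable $X$ following the Pseudo-Lindley law with parameters $\theta,\beta$ are $$\forall n\geq 1,\quad m_n=\frac{n!\,(\beta+n)}{\theta^n\beta}.$$ Moreover, any real-valued random variable $Y$ having the moments $(m_n)_{n\geq 1}$, i.e. such that $\mathbb{E}Y^n=m_n$ for all integers $n\geq 1$, follows the Pseudo-Lindley law with parameters $\theta,\beta$.
   Context: The Pseudo-Lindley law with parameters $\theta>0$ and $\beta>1$ is the probability law on $\mathbb{R}$ with density $$f(x)=\frac{\theta(\beta-1+\theta x)e^{-\theta x}}{\beta}\,1_{(x\geq 0)}.$$ *)

theory Defs
  imports "HOL-Probability.Probability"
begin

definition pseudo_lindley_density :: "real \<Rightarrow> real \<Rightarrow> real \<Rightarrow> real" where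
  "pseudo_lindley_density \<theta> \<beta> x =
     \<theta> * (\<beta> - 1 + \<theta> * x) * exp (- \<theta> * x) / \<beta> * indicator {0..} x"

lemma pseudo_lindley_density_measurable [measurable]:
  "pseudo_lindley_density \<theta> \<beta> \<in> borel_measurable borel"
  unfolding pseudo_lindley_density_def[abs_def] by measurable

lemma pseudo_lindley_density_nonneg:
  assumes "\<theta> > 0" "\<beta> > 1"
  shows "pseudo_lindley_density \<theta> \<beta> x \<ge> 0"
  using assms by (auto simp: pseudo_lindley_density_def indicator_def)

lemma pseudo_lindley_density_erlang:
  assumes "\<theta> > 0" "\<beta> > 1"
  shows "pseudo_lindley_density \<theta> \<beta> x =
    (\<beta> - 1) / \<beta> * erlang_density 0 \<theta> x + 1 / \<beta> * erlang_density 1 \<theta> x"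
  using assms
  by (auto simp: pseudo_lindley_density_def erlang_density_def indicator_def field_simps power2_eq_square)

lemma prob_space_pseudo_lindley:
  assumes "\<theta> > 0" "\<beta> > 1"
  shows "prob_space (density lborel (pseudo_lindley_density \<theta> \<beta>))"
proof
  have e: "(\<integral>\<^sup>+ x. ennreal (erlang_density k \<theta> x) \<partial>lborel) = 1" for k
    using prob_space.emeasure_space_1[OF prob_space_erlang_density[OF assms(1), of k]]
    by (simp add: emeasure_density)
  have "emeasure (density lborel (pseudo_lindley_density \<theta> \<beta>))
      (space (density lborel (pseudo_lindley_density \<theta> \<beta>))) =
    (\<integral>\<^sup>+ x. ennreal (pseudo_lindley_density \<theta> \<beta> x) \<partial>lborel)"
    by (simp add: emeasure_density)
  also have "\<dots> = (\<integral>\<^sup>+ x. ennreal ((\<beta> - 1) / \<beta>) * ennreal (erlang_density 0 \<theta> x) +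
      ennreal (1 / \<beta>) * ennreal (erlang_density 1 \<theta> x) \<partial>lborel)"
    using assms
    by (intro nn_integral_cong)
       (simp add: pseudo_lindley_density_erlang ennreal_plus[symmetric]
          ennreal_mult'[symmetric] del: ennreal_plus)
  also have "\<dots> = ennreal ((\<beta> - 1) / \<beta>) + ennreal (1 / \<beta>)"
    by (subst nn_integral_add) (auto simp: nn_integral_cmult e)
  also have "\<dots> = 1"
    using assms by (simp add: ennreal_plus[symmetric] field_simps del: ennreal_plus)
  finally show "emeasure (density lborel (pseudo_lindley_density \<theta> \<beta>))
      (space (density lborel (pseudo_lindley_density \<theta> \<beta>))) = 1" .
qed

end

theory Submission
  imports Defs
begin

text \<open>
  The pseudo-Lindley law is the mixture of the Erlang laws of shape 1 and 2 with weights
  \<open>(\<beta> - 1) / \<beta>\<close> and \<open>1 / \<beta>\<close>, so its moments are the same mixture of Erlang moments.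

  For the converse, its tail decays exponentially: \<open>exp (c * \<bar>x\<bar>)\<close> is integrable for every
  \<open>c < \<theta>\<close>, in particular for \<open>c = \<theta> / 2\<close>. A law with such an exponential moment is determined
  by its moments (\<open>moments_determine_real_distribution\<close>). The argument has two ingredients.
  The power series of \<open>cosh (c * x)\<close> has only even, hence nonnegative, terms, so its integral
  is a function of the moments alone; any other law with the same moments therefore has the same
  exponential moment (\<open>exp_abs_moment_transfer\<close>). Given this moment, the characteristic
  function and all its derivatives can be expanded around any point \<open>s\<close> in a power series
  that is valid at distance less than \<open>c\<close>, a radius that does not depend on \<open>s\<close>
  (\<open>oscillating_moment_shift_sums\<close>). Two laws with equal moments have equal derivatives at 0;
  finitely many steps of length less than \<open>c\<close> carry the equality to every real point, and a law
  is determined by its characteristic function.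
\<close>

section \<open>Laws with an exponential moment\<close>

lemma borel_measurable_real_fun:
  assumes "sets M = sets borel" "f \<in> borel_measurable borel"
  shows "f \<in> borel_measurable (M :: real measure)"
  using assms by (simp cong: measurable_cong_sets)

lemma power_le_fact_mult_exp:
  fixes y :: real
  assumes "y \<ge> 0"
  shows "y ^ k \<le> fact k * exp y"
proof -
  have s: "(\<lambda>n. y ^ n /\<^sub>R fact n) sums exp y"
    by (rule exp_converges)
  have "(\<Sum>n\<in>{k}. y ^ n /\<^sub>R fact n) \<le> exp y"
    unfolding sums_unique[OF s]
    by (rule sum_le_suminf) (use assms s in \<open>auto simp: sums_iff\<close>)
  then show ?thesis
    by (simp add: field_simps)
qed

text \<open>The slack \<open>c - d\<close> in the exponent absorbs any power of \<open>\<bar>x\<bar>\<close>.\<close>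

lemma integrable_power_mult_exp_abs:
  fixes M :: "real measure"
  assumes M: "sets M = sets borel" and c: "integrable M (\<lambda>x. exp (c * \<bar>x\<bar>))" and "d < c"
  shows "integrable M (\<lambda>x. \<bar>x\<bar> ^ k * exp (d * \<bar>x\<bar>))"
proof (rule Bochner_Integration.integrable_bound)
  let ?e = "c - d"
  show "integrable M (\<lambda>x. fact k / ?e ^ k * exp (c * \<bar>x\<bar>))"
    using c by simp
  show "(\<lambda>x. \<bar>x\<bar> ^ k * exp (d * \<bar>x\<bar>)) \<in> borel_measurable M"
    by (rule borel_measurable_real_fun[OF M]) measurable
  show "AE x in M. norm (\<bar>x\<bar> ^ k * exp (d * \<bar>x\<bar>)) \<le> norm (fact k / ?e ^ k * exp (c * \<bar>x\<bar>))"
  proof (rule AE_I2)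
    fix x
    have "(?e * \<bar>x\<bar>) ^ k \<le> fact k * exp (?e * \<bar>x\<bar>)"
      using \<open>d < c\<close> by (intro power_le_fact_mult_exp) auto
    then have "\<bar>x\<bar> ^ k \<le> fact k / ?e ^ k * exp (?e * \<bar>x\<bar>)"
      using \<open>d < c\<close> by (simp add: power_mult_distrib pos_le_divide_eq mult.commute)
    then have "\<bar>x\<bar> ^ k * exp (d * \<bar>x\<bar>) \<le> fact k / ?e ^ k * exp (?e * \<bar>x\<bar>) * exp (d * \<bar>x\<bar>)"
      by (rule mult_right_mono) simp
    also have "\<dots> = fact k / ?e ^ k * exp (c * \<bar>x\<bar>)"
      by (simp add: mult_exp_exp algebra_simps)
    finally show "norm (\<bar>x\<bar> ^ k * exp (d * \<bar>x\<bar>)) \<le> norm (fact k / ?e ^ k * exp (c * \<bar>x\<bar>))"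
      using \<open>d < c\<close> by (simp add: abs_mult)
  qed
qed

text \<open>
  Up to the factor \<open>\<i> ^ k\<close>, the \<open>k\<close>-th derivative at \<open>s\<close> of the characteristic function. The
  integral itself is the convenient object: it reduces to the \<open>k\<close>-th moment at \<open>s = 0\<close>, and
  no differentiation under the integral sign has to be justified.
\<close>

definition oscillating_moment :: "real measure \<Rightarrow> nat \<Rightarrow> real \<Rightarrow> complex" where
  "oscillating_moment M k s = (CLINT x|M. of_real (x ^ k) * iexp (s * x))"

text \<open>
  Taylor expansion around \<open>s\<close>. Expanding \<open>iexp (h * x)\<close> in its power series, all partial sums of
  the integrand are dominated by \<open>\<bar>x\<bar> ^ k * exp (\<bar>h\<bar> * \<bar>x\<bar>)\<close>, which is integrable since
  \<open>\<bar>h\<bar> < c\<close>, so the series may be integrated term by term.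
\<close>

lemma oscillating_moment_shift_sums:
  fixes M :: "real measure"
  assumes M: "sets M = sets borel" and c: "integrable M (\<lambda>x. exp (c * \<bar>x\<bar>))" and "\<bar>h\<bar> < c"
  shows "(\<lambda>j. (\<i> * of_real h) ^ j / fact j * oscillating_moment M (k + j) s)
           sums oscillating_moment M k (s + h)"
proof -
  define f :: "nat \<Rightarrow> real \<Rightarrow> complex" where
    "f j x = (\<i> * of_real h) ^ j / fact j * (of_real (x ^ (k + j)) * iexp (s * x))" for j x
  have f_alt: "f j x = of_real (x ^ k) * iexp (s * x) * ((\<i> * of_real (h * x)) ^ j /\<^sub>R fact j)" for j x
    by (simp add: f_def power_add power_mult_distrib scaleR_conv_of_real field_simps)
  have norm_f: "norm (f j x) = \<bar>x\<bar> ^ k * ((\<bar>h\<bar> * \<bar>x\<bar>) ^ j /\<^sub>R fact j)" for j x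
    unfolding f_alt by (simp add: norm_mult norm_power abs_mult power_abs del: of_real_mult of_real_power)
  have f_meas: "f j \<in> borel_measurable M" for j
    unfolding f_def by (rule borel_measurable_real_fun[OF M]) measurable
  have dominating: "integrable M (\<lambda>x. \<bar>x\<bar> ^ k * exp (\<bar>h\<bar> * \<bar>x\<bar>))"
    using M c \<open>\<bar>h\<bar> < c\<close> by (rule integrable_power_mult_exp_abs)
  have partial: "norm (\<Sum>j<n. f j x) \<le> \<bar>x\<bar> ^ k * exp (\<bar>h\<bar> * \<bar>x\<bar>)" for n x
  proof -
    have s: "(\<lambda>j. (\<bar>h\<bar> * \<bar>x\<bar>) ^ j /\<^sub>R fact j) sums exp (\<bar>h\<bar> * \<bar>x\<bar>)"
      by (rule exp_converges)
    have "norm (\<Sum>j<n. f j x) \<le> (\<Sum>j<n. norm (f j x))"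
      by (rule norm_sum)
    also have "\<dots> = \<bar>x\<bar> ^ k * (\<Sum>j<n. (\<bar>h\<bar> * \<bar>x\<bar>) ^ j /\<^sub>R fact j)"
      by (simp add: norm_f sum_distrib_left)
    also have "\<dots> \<le> \<bar>x\<bar> ^ k * exp (\<bar>h\<bar> * \<bar>x\<bar>)"
      unfolding sums_unique[OF s]
      by (intro mult_left_mono sum_le_suminf) (use s in \<open>auto simp: sums_iff\<close>)
    finally show ?thesis .
  qed
  have f_int: "integrable M (f j)" for j
  proof (rule Bochner_Integration.integrable_bound[OF dominating f_meas], rule AE_I2)
    fix x
    have "(\<bar>h\<bar> * \<bar>x\<bar>) ^ j /\<^sub>R fact j \<le> exp (\<bar>h\<bar> * \<bar>x\<bar>)"
      using power_le_fact_mult_exp[of "\<bar>h\<bar> * \<bar>x\<bar>" j] by (simp add: field_simps)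
    then show "norm (f j x) \<le> norm (\<bar>x\<bar> ^ k * exp (\<bar>h\<bar> * \<bar>x\<bar>))"
      unfolding norm_f by (simp add: abs_mult mult_left_mono)
  qed
  have pointwise: "(\<lambda>n. \<Sum>j<n. f j x) \<longlonglongrightarrow> of_real (x ^ k) * iexp ((s + h) * x)" for x
  proof -
    have "(\<lambda>j. (\<i> * of_real (h * x)) ^ j /\<^sub>R fact j) sums iexp (h * x)"
      by (rule exp_converges)
    then have "(\<lambda>j. f j x) sums (of_real (x ^ k) * iexp (s * x) * iexp (h * x))"
      unfolding f_alt by (rule sums_mult)
    also have "of_real (x ^ k) * iexp (s * x) * iexp (h * x) = of_real (x ^ k) * iexp ((s + h) * x)"
      by (simp add: exp_add[symmetric] algebra_simps)
    finally show ?thesis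
      by (simp add: sums_def)
  qed
  have "(\<lambda>n. CLINT x|M. (\<Sum>j<n. f j x)) \<longlonglongrightarrow> (CLINT x|M. of_real (x ^ k) * iexp ((s + h) * x))"
    by (rule integral_dominated_convergence[OF _ _ dominating])
       (use partial pointwise f_meas in \<open>auto intro!: borel_measurable_real_fun[OF M]\<close>)
  moreover have "(CLINT x|M. f j x) = (\<i> * of_real h) ^ j / fact j * oscillating_moment M (k + j) s" for j
    unfolding f_def oscillating_moment_def by (rule integral_mult_right_zero)
  then have "(CLINT x|M. (\<Sum>j<n. f j x)) =
      (\<Sum>j<n. (\<i> * of_real h) ^ j / fact j * oscillating_moment M (k + j) s)" for n
    using f_int by (subst Bochner_Integration.integral_sum) simp_all
  ultimately show ?thesis
    by (simp add: sums_def oscillating_moment_def)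
qed

text \<open>
  \<open>cosh (c * x)\<close> and \<open>exp (c * \<bar>x\<bar>)\<close> agree up to a factor 2, and the former is a power series in
  \<open>x\<close> with nonnegative terms. By monotone convergence its integral, finite or not, is determined
  by the moments.
\<close>

lemma exp_abs_moment_transfer:
  fixes M N :: "real measure"
  assumes M: "sets M = sets borel" and N: "sets N = sets borel"
    and "c \<ge> 0" and c: "integrable M (\<lambda>x. exp (c * \<bar>x\<bar>))"
    and iM: "\<And>n. integrable M (\<lambda>x. x ^ n)" and iN: "\<And>n. integrable N (\<lambda>x. x ^ n)"
    and eq: "\<And>n. (\<integral>x. x ^ n \<partial>M) = (\<integral>x. x ^ n \<partial>N)"
  shows "integrable N (\<lambda>x. exp (c * \<bar>x\<bar>))"
proof -
  define a where "a n = (if even n then c ^ n / fact n else 0)" for n :: nat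
  have a_nonneg: "a n * x ^ n \<ge> 0" for n x
    by (auto simp: a_def zero_le_even_power)
  have cosh_series: "(\<lambda>n. a n * x ^ n) sums cosh (c * x)" for x
    using cosh_converges[of "c * x"]
    by (rule back_subst[of "\<lambda>f. f sums _"]) (auto simp: a_def power_mult_distrib field_simps)
  have nn_cosh: "(\<integral>\<^sup>+x. ennreal (cosh (c * x)) \<partial>L) = (\<Sum>n. ennreal (a n * (\<integral>x. x ^ n \<partial>L)))"
    if L: "sets L = sets borel" and iL: "\<And>n. integrable L (\<lambda>x. x ^ n)" for L :: "real measure"
  proof -
    have "(\<integral>\<^sup>+x. ennreal (cosh (c * x)) \<partial>L) = (\<integral>\<^sup>+x. (\<Sum>n. ennreal (a n * x ^ n)) \<partial>L)"
    proof (rule nn_integral_cong)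
      fix x
      show "ennreal (cosh (c * x)) = (\<Sum>n. ennreal (a n * x ^ n))"
        using suminf_ennreal_eq[OF a_nonneg cosh_series[of x]] by simp
    qed
    also have "\<dots> = (\<Sum>n. \<integral>\<^sup>+x. ennreal (a n * x ^ n) \<partial>L)"
      by (rule nn_integral_suminf) (rule borel_measurable_real_fun[OF L], measurable)
    also have "\<dots> = (\<Sum>n. ennreal (a n * (\<integral>x. x ^ n \<partial>L)))"
      by (subst nn_integral_eq_integral) (use iL a_nonneg in auto)
    finally show ?thesis .
  qed
  have "integrable M (\<lambda>x. cosh (c * x))"
  proof (rule Bochner_Integration.integrable_bound[OF c])
    show "(\<lambda>x. cosh (c * x)) \<in> borel_measurable M"
      unfolding cosh_def by (rule borel_measurable_real_fun[OF M]) measurable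
    show "AE x in M. norm (cosh (c * x)) \<le> norm (exp (c * \<bar>x\<bar>))"
    proof (rule AE_I2)
      fix x
      have "exp (c * x) \<le> exp (c * \<bar>x\<bar>)" "exp (- (c * x)) \<le> exp (c * \<bar>x\<bar>)"
        using \<open>c \<ge> 0\<close> by (auto simp: abs_if mult_le_0_iff zero_le_mult_iff)
      then have "cosh (c * x) \<le> exp (c * \<bar>x\<bar>)"
        unfolding cosh_def by (simp del: exp_le_cancel_iff)
      then show "norm (cosh (c * x)) \<le> norm (exp (c * \<bar>x\<bar>))"
        by simp
    qed
  qed
  then have "(\<integral>\<^sup>+x. ennreal (cosh (c * x)) \<partial>M) < \<infinity>"
    by (subst nn_integral_eq_integral) auto
  then have "(\<integral>\<^sup>+x. ennreal (cosh (c * x)) \<partial>N) < \<infinity>"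
    using nn_cosh[OF M iM] nn_cosh[OF N iN] eq by simp
  then have "integrable N (\<lambda>x. cosh (c * x))"
    by (intro integrableI_nonneg borel_measurable_real_fun[OF N]) (auto simp: cosh_def)
  then have "integrable N (\<lambda>x. 2 * cosh (c * x))"
    by simp
  then show ?thesis
  proof (rule Bochner_Integration.integrable_bound)
    show "(\<lambda>x. exp (c * \<bar>x\<bar>)) \<in> borel_measurable N"
      by (rule borel_measurable_real_fun[OF N]) measurable
    show "AE x in N. norm (exp (c * \<bar>x\<bar>)) \<le> norm (2 * cosh (c * x))"
    proof (rule AE_I2)
      fix x
      have "exp (c * \<bar>x\<bar>) \<le> exp (c * x) + exp (- (c * x))"
        by (simp add: abs_if)
      also have "\<dots> = 2 * cosh (c * x)"
        by (simp add: cosh_def)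
      finally show "norm (exp (c * \<bar>x\<bar>)) \<le> norm (2 * cosh (c * x))"
        by simp
    qed
  qed
qed

text \<open>
  The exponential moment of \<open>M\<close> passes to \<open>N\<close>, so the Taylor expansion is available for both: if all oscillating moments agree at \<open>s\<close> then they agree at \<open>s + h\<close> whenever \<open>\<bar>h\<bar> < c\<close>;
  carrying all orders \<open>k\<close> along is what lets this step be iterated from 0 to \<open>t\<close>.
\<close>

theorem moments_determine_real_distribution:
  fixes M N :: "real measure"
  assumes M: "real_distribution M" and N: "real_distribution N"
    and "c > 0" and c: "integrable M (\<lambda>x. exp (c * \<bar>x\<bar>))"
    and iN: "\<And>n. integrable N (\<lambda>x. x ^ n)"
    and eq: "\<And>n. (\<integral>x. x ^ n \<partial>M) = (\<integral>x. x ^ n \<partial>N)"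
  shows "M = N"
proof (rule Levy_uniqueness[OF M N], rule ext)
  interpret M: real_distribution M by fact
  interpret N: real_distribution N by fact
  have iM: "integrable M (\<lambda>x. x ^ n)" for n
    using integrable_power_mult_exp_abs[OF M.events_eq_borel c \<open>c > 0\<close>, of n]
    by (rule Bochner_Integration.integrable_bound)
       (auto intro!: borel_measurable_real_fun[OF M.events_eq_borel] simp: power_abs)
  have cN: "integrable N (\<lambda>x. exp (c * \<bar>x\<bar>))"
    by (rule exp_abs_moment_transfer[OF _ _ _ c iM iN eq]) (use \<open>c > 0\<close> in simp_all)
  have shift: "\<forall>k. oscillating_moment M k (s + h) = oscillating_moment N k (s + h)"
    if "\<forall>k. oscillating_moment M k s = oscillating_moment N k s" "\<bar>h\<bar> < c" for s h
  proof
    fix k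
    show "oscillating_moment M k (s + h) = oscillating_moment N k (s + h)"
      using oscillating_moment_shift_sums[OF M.events_eq_borel c \<open>\<bar>h\<bar> < c\<close>, of k s]
        oscillating_moment_shift_sums[OF N.events_eq_borel cN \<open>\<bar>h\<bar> < c\<close>, of k s] that(1)
      by (simp add: sums_iff)
  qed
  fix t :: real
  \<comment> \<open>Cut the way from 0 to \<open>t\<close> into \<open>m\<close> steps shorter than \<open>c\<close>.\<close>
  obtain m :: nat where m: "\<bar>t\<bar> / c < real m"
    using reals_Archimedean2 by blast
  then have "real m > 0"
    using \<open>c > 0\<close> by (meson abs_ge_zero divide_nonneg_pos le_less_trans)
  then have "\<bar>t / m\<bar> < c"
    using m \<open>c > 0\<close> by (simp add: field_simps)
  have "\<forall>k. oscillating_moment M k (real j * (t / m)) = oscillating_moment N k (real j * (t / m))" for j :: nat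
  proof (induction j)
    case 0
    show ?case
      by (simp add: oscillating_moment_def eq del: of_real_power)
  next
    case (Suc j)
    have "real j * (t / m) + t / m = real (Suc j) * (t / m)"
      by (simp add: distrib_right add_divide_distrib)
    with shift[OF Suc \<open>\<bar>t / m\<bar> < c\<close>] show ?case
      by metis
  qed
  from this[of m] have "oscillating_moment M 0 t = oscillating_moment N 0 t"
    using \<open>real m > 0\<close> by simp
  then show "char M t = char N t"
    by (simp add: oscillating_moment_def char_def)
qed

section \<open>The pseudo-Lindley law\<close>

lemma has_bochner_integral_erlang_density_power:
  assumes "l > 0"
  shows "has_bochner_integral lborel (\<lambda>x. erlang_density k l x * x ^ n) (fact (k + n) / (fact k * l ^ n))"
proof (rule has_bochner_integral_nn_integral)
  show "AE x in lborel. 0 \<le> erlang_density k l x * x ^ n"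
    using assms by (auto simp: erlang_density_def)
  show "(\<integral>\<^sup>+x. ennreal (erlang_density k l x * x ^ n) \<partial>lborel) = ennreal (fact (k + n) / (fact k * l ^ n))"
    using nn_integral_erlang_ith_moment[OF assms, of k n]
    by (simp add: ennreal_mult')
qed (use assms in auto)

lemma has_bochner_integral_pseudo_lindley_power:
  assumes "\<theta> > 0" "\<beta> > 1"
  shows "has_bochner_integral lborel (\<lambda>x. pseudo_lindley_density \<theta> \<beta> x * x ^ n)
           (fact n * (\<beta> + real n) / (\<theta> ^ n * \<beta>))"
proof -
  have "has_bochner_integral lborel
      (\<lambda>x. (\<beta> - 1) / \<beta> * (erlang_density 0 \<theta> x * x ^ n) + 1 / \<beta> * (erlang_density 1 \<theta> x * x ^ n))
      ((\<beta> - 1) / \<beta> * (fact (0 + n) / (fact 0 * \<theta> ^ n)) + 1 / \<beta> * (fact (1 + n) / (fact 1 * \<theta> ^ n)))"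
    by (intro has_bochner_integral_add has_bochner_integral_mult_right
        has_bochner_integral_erlang_density_power assms)
  also have "(\<lambda>x. (\<beta> - 1) / \<beta> * (erlang_density 0 \<theta> x * x ^ n) + 1 / \<beta> * (erlang_density 1 \<theta> x * x ^ n)) =
      (\<lambda>x. pseudo_lindley_density \<theta> \<beta> x * x ^ n)"
    by (simp add: pseudo_lindley_density_erlang[OF assms] algebra_simps)
  also have "(\<beta> - 1) / \<beta> * (fact (0 + n) / (fact 0 * \<theta> ^ n)) + 1 / \<beta> * (fact (1 + n) / (fact 1 * \<theta> ^ n)) =
      fact n * (\<beta> + real n) / (\<theta> ^ n * \<beta>)"
    using assms by (simp add: field_simps)
  finally show ?thesis .
qed

text \<open>
  Tilting by \<open>exp (\<theta> / 2 * x)\<close> turns an Erlang density of rate \<open>\<theta>\<close> and shape \<open>k + 1\<close> into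
  \<open>2 ^ (k + 1)\<close> times the Erlang density of rate \<open>\<theta> / 2\<close> and the same shape.
\<close>

lemma integrable_pseudo_lindley_exp:
  assumes "\<theta> > 0" "\<beta> > 1"
  shows "integrable lborel (\<lambda>x. pseudo_lindley_density \<theta> \<beta> x * exp (\<theta> / 2 * \<bar>x\<bar>))"
proof -
  have e: "integrable lborel (erlang_density k (\<theta> / 2))" for k
    using has_bochner_integral_erlang_density_power[of "\<theta> / 2" k 0] assms
    by (auto simp: has_bochner_integral_iff)
  have "pseudo_lindley_density \<theta> \<beta> x * exp (\<theta> / 2 * \<bar>x\<bar>) =
      2 * (\<beta> - 1) / \<beta> * erlang_density 0 (\<theta> / 2) x + 4 / \<beta> * erlang_density 1 (\<theta> / 2) x" for x
  proof (cases "x \<ge> 0")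
    case True
    have *: "exp (- (\<theta> * x)) * exp (\<theta> * x / 2) = exp (- (\<theta> * x / 2))"
      by (simp add: mult_exp_exp)
    have "pseudo_lindley_density \<theta> \<beta> x * exp (\<theta> / 2 * \<bar>x\<bar>) =
        \<theta> * (\<beta> - 1 + \<theta> * x) / \<beta> * (exp (- (\<theta> * x)) * exp (\<theta> * x / 2))"
      using True by (simp add: pseudo_lindley_density_def)
    also have "\<dots> = 2 * (\<beta> - 1) / \<beta> * erlang_density 0 (\<theta> / 2) x + 4 / \<beta> * erlang_density 1 (\<theta> / 2) x"
      unfolding * using True assms
      by (simp add: erlang_density_def field_simps power2_eq_square)
    finally show ?thesis .
  qed (simp add: pseudo_lindley_density_def erlang_density_def)
  then show ?thesis
    using e by simp
qed

theorem theorem4: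
  fixes \<theta> \<beta> :: real
    and M :: "'a measure" and X :: "'a \<Rightarrow> real"
    and N :: "'b measure" and Y :: "'b \<Rightarrow> real"
  assumes "\<theta> > 0" and "\<beta> > 1"
    and "prob_space M" and "prob_space N"
  shows "(distributed M lborel X (\<lambda>x. ennreal (pseudo_lindley_density \<theta> \<beta> x)) \<longrightarrow>
           (\<forall>n::nat. n \<ge> 1 \<longrightarrow>
              integrable M (\<lambda>\<omega>. X \<omega> ^ n) \<and>
              prob_space.expectation M (\<lambda>\<omega>. X \<omega> ^ n)
                = fact n * (\<beta> + real n) / (\<theta> ^ n * \<beta>)))
       \<and> (Y \<in> borel_measurable N \<and>
           (\<forall>n::nat. n \<ge> 1 \<longrightarrow>
              integrable N (\<lambda>\<omega>. Y \<omega> ^ n) \<and>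
              prob_space.expectation N (\<lambda>\<omega>. Y \<omega> ^ n)
                = fact n * (\<beta> + real n) / (\<theta> ^ n * \<beta>))
           \<longrightarrow> distributed N lborel Y (\<lambda>x. ennreal (pseudo_lindley_density \<theta> \<beta> x)))"
proof (intro conjI impI allI)
  note nonneg = pseudo_lindley_density_nonneg[OF assms(1,2)]
  note moment = has_bochner_integral_pseudo_lindley_power[OF assms(1,2)]
  {
    fix n :: nat
    assume X: "distributed M lborel X (\<lambda>x. ennreal (pseudo_lindley_density \<theta> \<beta> x))"
    show "integrable M (\<lambda>\<omega>. X \<omega> ^ n)"
      using distributed_integrable[OF X, of "\<lambda>x. x ^ n"] moment[of n] nonneg
      by (simp add: has_bochner_integral_iff)
    show "prob_space.expectation M (\<lambda>\<omega>. X \<omega> ^ n) = fact n * (\<beta> + real n) / (\<theta> ^ n * \<beta>)"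
      using distributed_integral[OF X, of "\<lambda>x. x ^ n"] moment[of n] nonneg
      by (simp add: has_bochner_integral_iff)
  }
  assume Y: "Y \<in> borel_measurable N \<and>
           (\<forall>n::nat. n \<ge> 1 \<longrightarrow>
              integrable N (\<lambda>\<omega>. Y \<omega> ^ n) \<and>
              prob_space.expectation N (\<lambda>\<omega>. Y \<omega> ^ n)
                = fact n * (\<beta> + real n) / (\<theta> ^ n * \<beta>))"
  interpret N: prob_space N by fact
  let ?L = "density lborel (pseudo_lindley_density \<theta> \<beta>)"
  let ?D = "distr N borel Y"
  have Y_meas [measurable]: "Y \<in> borel_measurable N"
    using Y by simp
  have Y_int: "integrable N (\<lambda>\<omega>. Y \<omega> ^ n)" for n
    using Y by (cases "n = 0") auto
  \<comment> \<open>The formula for the moments also gives the total mass 1 at \<open>n = 0\<close>.\<close>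
  have Y_moment: "(\<integral>\<omega>. Y \<omega> ^ n \<partial>N) = fact n * (\<beta> + real n) / (\<theta> ^ n * \<beta>)" for n
    using Y assms by (cases "n = 0") (auto simp: N.prob_space)
  have "?L = ?D"
  proof (rule moments_determine_real_distribution)
    interpret L: prob_space ?L
      using assms(1,2) by (rule prob_space_pseudo_lindley)
    show "real_distribution ?L"
      by unfold_locales simp
    show "real_distribution ?D"
      by (rule N.real_distribution_distr) simp
    show "\<theta> / 2 > 0"
      using assms by simp
    show "integrable ?L (\<lambda>x. exp (\<theta> / 2 * \<bar>x\<bar>))"
      using integrable_pseudo_lindley_exp[OF assms(1,2)] nonneg
      by (subst integrable_density) auto
    show "integrable ?D (\<lambda>x. x ^ n)" for n
      using Y_int by (subst integrable_distr_eq) auto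
    show "(\<integral>x. x ^ n \<partial>?L) = (\<integral>x. x ^ n \<partial>?D)" for n
    proof -
      have "(\<integral>x. x ^ n \<partial>?L) = (\<integral>x. pseudo_lindley_density \<theta> \<beta> x * x ^ n \<partial>lborel)"
        using nonneg by (subst integral_density) auto
      also have "\<dots> = (\<integral>\<omega>. Y \<omega> ^ n \<partial>N)"
        using moment[of n] by (simp add: has_bochner_integral_iff Y_moment)
      also have "\<dots> = (\<integral>x. x ^ n \<partial>?D)"
        by (subst integral_distr) auto
      finally show ?thesis .
    qed
  qed
  moreover have "distr N lborel Y = ?D"
    by (rule distr_cong) auto
  ultimately show "distributed N lborel Y (\<lambda>x. ennreal (pseudo_lindley_density \<theta> \<beta> x))"
    by (simp add: distributed_def)
qed

end
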